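(* The satisfaction system $\Lambda_{\mathrm{Horn}}=(\mathcal{L}_{\mathrm{Horn}},\mathfrak{M}_{\mathrm{Prop}},\models_{\mathrm{Prop}})$ of propositional Horn logic is both eviction-compatible and reception-compatible.
   Context: Let $\mathcal{P}$ be a finite set of propositional atoms containing the constant $\bot$ (falsum). $\mathcal{L}_{\mathrm{Horn}}$ is generated by the grammar $\varphi::=\varphi\wedge\varphi\mid H\mid T\to H$, $T::=T\wedge T\mid H$, $H::=p$ with $p\in\mathcal{P}$. $\mathfrak{M}_{\mathrm{Prop}}$ is the set of Boolean valuations of the atoms (with $\bot$ always false), and $v\models_{\mathrm{Prop}}B$ iff $v$ satisfies every formula of $B$ under classical semantics. For a satisfaction system $\Lambda=(\mathcal{L},\mathfrak{M},\models)$: $\mathrm{Mod}(B)=\{m\in\mathfrak{M}\mid m\models B\}$; $\mathrm{FR}(\Lambda)=\{\mathrm{Mod}(B)\mid B\subseteq\mathcal{L}$ finite$\}$; $\mathrm{FRsubs}(\mathbb{M},\Lambda)$ is the set of $\subseteq$-maximal elements of $\{X\in\mathrm{FR}(\Lambda)\mid X\subseteq\mathbb{M}\}$ and $\mathrm{FRsups}(\mathbb{M},\Lambda)$ the set of $\subseteq$-minimal elements of $\{X\in\mathrm{FR}(\Lambda)\mid\mathbb{M}\subseteq X\}$. $\Lambda$ is eviction-compatible if $\mathrm{FRsubs}(\mathrm{Mod}(B)\setminus\mathbb{M},\Lambda)\neq\emptyset$ for all finite $B\subseteq\mathcal{L}$ and $\mathbb{M}\subseteq\mathfrak{M}$; it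 is reception-compatible if $\mathrm{FRsups}(\mathrm{Mod}(B)\cup\mathbb{M},\Lambda)\neq\emptyset$ for all finite $B$ and $\mathbb{M}$. *)

theory Defs
  imports "HOL-Library.FuncSet"
begin

text \<open>Satisfaction is a relation between models and bases (sets of formulas).\<close>

record ('f, 'm) satisfaction_system =
  lang :: "'f set"
  mods :: "'m set"
  sat :: "'m \<Rightarrow> 'f set \<Rightarrow> bool"

definition Mod :: "('f, 'm) satisfaction_system \<Rightarrow> 'f set \<Rightarrow> 'm set" where
  "Mod \<Lambda> B = {m \<in> mods \<Lambda>. sat \<Lambda> m B}"

definition FR :: "('f, 'm) satisfaction_system \<Rightarrow> 'm set set" where
  "FR \<Lambda> = {Mod \<Lambda> B | B. finite B \<and> B \<subseteq> lang \<Lambda>}"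

definition FRsubs :: "'m set \<Rightarrow> ('f, 'm) satisfaction_system \<Rightarrow> 'm set set" where
  "FRsubs M \<Lambda> = {X \<in> FR \<Lambda>. X \<subseteq> M \<and> \<not> (\<exists>Y \<in> FR \<Lambda>. Y \<subseteq> M \<and> X \<subset> Y)}"

definition FRsups :: "'m set \<Rightarrow> ('f, 'm) satisfaction_system \<Rightarrow> 'm set set" where
  "FRsups M \<Lambda> = {X \<in> FR \<Lambda>. M \<subseteq> X \<and> \<not> (\<exists>Y \<in> FR \<Lambda>. M \<subseteq> Y \<and> Y \<subset> X)}"

definition eviction_compatible :: "('f, 'm) satisfaction_system \<Rightarrow> bool" where
  "eviction_compatible \<Lambda> \<longleftrightarrow>
     (\<forall>B M. finite B \<and> B \<subseteq> lang \<Lambda> \<and> M \<subseteq> mods \<Lambda> \<longrightarrow> FRsubs (Mod \<Lambda> B - M) \<Lambda> \<noteq> {})"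

definition reception_compatible :: "('f, 'm) satisfaction_system \<Rightarrow> bool" where
  "reception_compatible \<Lambda> \<longleftrightarrow>
     (\<forall>B M. finite B \<and> B \<subseteq> lang \<Lambda> \<and> M \<subseteq> mods \<Lambda> \<longrightarrow> FRsups (Mod \<Lambda> B \<union> M) \<Lambda> \<noteq> {})"

text \<open>Falsum is not a constructor: it is one of the atoms, and every admissible
  valuation makes it false.\<close>

datatype 'a form = Atom 'a | And "'a form" "'a form" | Imp "'a form" "'a form"

primrec holds :: "('a \<Rightarrow> bool) \<Rightarrow> 'a form \<Rightarrow> bool" where
  "holds v (Atom p) \<longleftrightarrow> v p"
| "holds v (And \<phi> \<psi>) \<longleftrightarrow> holds v \<phi> \<and> holds v \<psi>"
| "holds v (Imp \<phi> \<psi>) \<longleftrightarrow> (holds v \<phi> \<longrightarrow> holds v \<psi>)"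

text \<open>One inductive set for each of the nonterminals \<open>H\<close>, \<open>T\<close> and \<open>\<phi>\<close> of the Horn grammar.\<close>

inductive_set horn_head :: "'a set \<Rightarrow> 'a form set" for P :: "'a set" where
  atom: "p \<in> P \<Longrightarrow> Atom p \<in> horn_head P"

inductive_set horn_body :: "'a set \<Rightarrow> 'a form set" for P :: "'a set" where
  conj: "S \<in> horn_body P \<Longrightarrow> T \<in> horn_body P \<Longrightarrow> And S T \<in> horn_body P"
| head: "H \<in> horn_head P \<Longrightarrow> H \<in> horn_body P"

inductive_set horn_lang :: "'a set \<Rightarrow> 'a form set" for P :: "'a set" where
  conj: "\<phi> \<in> horn_lang P \<Longrightarrow> \<psi> \<in> horn_lang P \<Longrightarrow> And \<phi> \<psi> \<in> horn_lang P"
| head: "H \<in> horn_head P \<Longrightarrow> H \<in> horn_lang P"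
| imp: "T \<in> horn_body P \<Longrightarrow> H \<in> horn_head P \<Longrightarrow> Imp T H \<in> horn_lang P"

text \<open>Valuations are extensional on the atom set, so that two valuations agreeing on all
  atoms are the same model.\<close>

definition prop_valuations :: "'a set \<Rightarrow> 'a \<Rightarrow> ('a \<Rightarrow> bool) set" where
  "prop_valuations P falsum = {v \<in> P \<rightarrow>\<^sub>E UNIV. \<not> v falsum}"

definition prop_sat :: "('a \<Rightarrow> bool) \<Rightarrow> 'a form set \<Rightarrow> bool" where
  "prop_sat v B \<longleftrightarrow> (\<forall>\<phi> \<in> B. holds v \<phi>)"

definition horn_system :: "'a set \<Rightarrow> 'a \<Rightarrow> ('a form, 'a \<Rightarrow> bool) satisfaction_system" where
  "horn_system P falsum =
     \<lparr>lang = horn_lang P, mods = prop_valuations P falsum, sat = prop_sat\<rparr>"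

end

theory Submission
  imports Defs
begin

text \<open>There are only finitely many valuations, hence only finitely many finitely representable
  sets of models. So maximal subsets and minimal supersets exist as soon as there is one
  candidate: \<open>\<bottom>\<close> has no model at all, and the empty base has every model.\<close>

lemma finite_FR:
  assumes "finite (mods \<Lambda>)"
  shows "finite (FR \<Lambda>)"
proof (rule finite_subset)
  \<comment> \<open>The bound counts sets of models rather than bases, so an infinite language does
    no harm.\<close>
  show "FR \<Lambda> \<subseteq> Pow (mods \<Lambda>)"
    by (auto simp: FR_def Mod_def)
qed (simp add: assms)

text \<open>A finite nonempty family of sets has an inclusion-maximal member; the candidate
  \<open>X\<close> witnesses nonemptiness.\<close>

lemma FRsubs_nonempty:
  assumes "finite (mods \<Lambda>)" and "X \<in> FR \<Lambda>" and "X \<subseteq> M"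
  shows "FRsubs M \<Lambda> \<noteq> {}"
proof -
  let ?C = "{X \<in> FR \<Lambda>. X \<subseteq> M}"
  have "finite ?C" "?C \<noteq> {}"
    using finite_FR[OF assms(1)] assms(2,3) by auto
  from finite_has_maximal[OF this]
  obtain Y where "Y \<in> ?C" and "\<forall>Z\<in>?C. Y \<subseteq> Z \<longrightarrow> Y = Z" ..
  then have "Y \<in> FRsubs M \<Lambda>"
    by (auto simp: FRsubs_def)
  then show ?thesis by blast
qed

lemma FRsups_nonempty:
  assumes "finite (mods \<Lambda>)" and "X \<in> FR \<Lambda>" and "M \<subseteq> X"
  shows "FRsups M \<Lambda> \<noteq> {}"
proof -
  let ?C = "{X \<in> FR \<Lambda>. M \<subseteq> X}"
  have "finite ?C" "?C \<noteq> {}"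
    using finite_FR[OF assms(1)] assms(2,3) by auto
  from finite_has_minimal[OF this]
  obtain Y where "Y \<in> ?C" and "\<forall>Z\<in>?C. Z \<subseteq> Y \<longrightarrow> Y = Z" ..
  then have "Y \<in> FRsups M \<Lambda>"
    by (auto simp: FRsups_def)
  then show ?thesis by blast
qed

text \<open>Extensionality fixes each valuation to \<open>undefined\<close> off \<open>P\<close>, so
  only its values on a finite set vary.\<close>

lemma finite_prop_valuations: "finite P \<Longrightarrow> finite (prop_valuations P falsum)"
  by (simp add: prop_valuations_def finite_PiE)

lemma empty_in_FR_horn:
  assumes "falsum \<in> P"
  shows "{} \<in> FR (horn_system P falsum)"
proof -
  \<comment> \<open>Falsum is itself an atom, so it may be asserted as a Horn fact, and every
    admissible valuation refutes it.\<close>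
  have "Mod (horn_system P falsum) {Atom falsum} = {}"
    by (auto simp: Mod_def horn_system_def prop_sat_def prop_valuations_def)
  moreover have "Atom falsum \<in> lang (horn_system P falsum)"
    using assms by (simp add: horn_system_def horn_lang.head horn_head.atom)
  ultimately show ?thesis
    unfolding FR_def by (auto intro!: exI[of _ "{Atom falsum}"])
qed

lemma mods_in_FR_horn: "mods (horn_system P falsum) \<in> FR (horn_system P falsum)"
  unfolding FR_def by (auto simp: Mod_def horn_system_def prop_sat_def intro!: exI[of _ "{}"])

theorem theorem5:
  fixes P :: "'a set" and falsum :: 'a
  assumes "finite P" and "falsum \<in> P"
  shows "eviction_compatible (horn_system P falsum) \<and> reception_compatible (horn_system P falsum)"
proof -
  have fin: "finite (mods (horn_system P falsum))"
    using finite_prop_valuations[OF assms(1)] by (simp add: horn_system_def)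
  \<comment> \<open>The empty set lies below every target, so one candidate serves all
    cases.\<close>
  have "eviction_compatible (horn_system P falsum)"
    unfolding eviction_compatible_def
    using FRsubs_nonempty[OF fin empty_in_FR_horn[OF assms(2)]] by blast
  moreover have "reception_compatible (horn_system P falsum)"
    unfolding reception_compatible_def
  proof (intro allI impI, elim conjE)
    fix B M
    \<comment> \<open>This keeps the target inside the set of all models, the candidate
      superset.\<close>
    assume "M \<subseteq> mods (horn_system P falsum)"
    then have "Mod (horn_system P falsum) B \<union> M \<subseteq> mods (horn_system P falsum)"
      by (auto simp: Mod_def)
    then show "FRsups (Mod (horn_system P falsum) B \<union> M) (horn_system P falsum) \<noteq> {}"
      by (rule FRsups_nonempty[OF fin mods_in_FR_horn])
  qed
  ultimately show ?thesis ..
qed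

end
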